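(* There exists a sequence $\{G_N\}_{N\ge1}$ of bounded functions on $\mathbb{R}^2$ such that $\sup_{N\ge1}\|G_N\|_{BMO(\mathbb{R}^2)}<\infty$ but $$\lim_{N\to\infty}\|M_{e_1}(G_N)\|_{BMO(\mathbb{R}^2)}=\infty,\qquad \lim_{N\to\infty}\|M_s(G_N)\|_{BMO(\mathbb{R}^2)}=\infty .$$
   Context: For $f\in L^1_{loc}(\mathbb{R}^2)$ and a measurable set $A$ of positive finite measure, $f_A=\frac{1}{|A|}\int_A f$ and $O(f,A)=\frac{1}{|A|}\int_A|f-f_A|$. $\|f\|_{BMO(\mathbb{R}^2)}=\sup_Q O(f,Q)$, the supremum over all closed squares $Q$ with sides parallel to the axes. The directional maximal operator in the direction $e_1=(1,0)$ is $M_{e_1}f(x_1,x_2)=\sup_{I\ni x_1}\frac{1}{|I|}\int_I|f(t,x_2)|\,dt$, the supremum over all closed bounded intervals $I\subset\mathbb{R}$ (of positive length) containing $x_1$. The strong maximal operator is $M_sf(x)=\sup_{R\ni x}\frac{1}{|R|}\int_R|f|$, the supremum over all closed bounded (nondegenerate) rectangles $R$ with sides parallel to the axes containing $x$. *)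

theory Defs
  imports "HOL-Analysis.Analysis"
begin

definition avg :: "('a::euclidean_space \<Rightarrow> real) \<Rightarrow> 'a set \<Rightarrow> real" where
  "avg f A = (1 / measure lebesgue A) * (LINT x:A|lebesgue. f x)"

text \<open>The average of \<open>\<bar>f\<bar>\<close> over \<open>A\<close>, with values in \<open>[0, \<infinity>]\<close>; used only for \<open>A\<close> of positive
  finite measure.\<close>

definition abs_avg :: "('a::euclidean_space \<Rightarrow> real) \<Rightarrow> 'a set \<Rightarrow> ennreal" where
  "abs_avg f A = (\<integral>\<^sup>+x\<in>A. ennreal \<bar>f x\<bar> \<partial>lebesgue) / emeasure lebesgue A"

definition mean_osc :: "('a::euclidean_space \<Rightarrow> real) \<Rightarrow> 'a set \<Rightarrow> ennreal" where
  "mean_osc f A = abs_avg (\<lambda>x. f x - avg f A) A"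

definition closed_squares :: "(real \<times> real) set set" where
  "closed_squares = {{a..a + l} \<times> {b..b + l} | a b l. l > 0}"

definition closed_rectangles :: "(real \<times> real) set set" where
  "closed_rectangles = {{a..b} \<times> {c..d} | a b c d. a < b \<and> c < d}"

definition closed_intervals :: "real set set" where
  "closed_intervals = {{a..b} | a b. a < b}"

text \<open>Meaningful for locally integrable \<open>f\<close>.\<close>

definition bmo_norm :: "(real \<times> real \<Rightarrow> real) \<Rightarrow> ennreal" where
  "bmo_norm f = (SUP Q\<in>closed_squares. mean_osc f Q)"

definition max_e1 :: "(real \<times> real \<Rightarrow> real) \<Rightarrow> real \<times> real \<Rightarrow> ennreal" where
  "max_e1 f x = (SUP I\<in>{I \<in> closed_intervals. fst x \<in> I}. abs_avg (\<lambda>t. f (t, snd x)) I)"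

definition strong_max :: "(real \<times> real \<Rightarrow> real) \<Rightarrow> real \<times> real \<Rightarrow> ennreal" where
  "strong_max f x = (SUP R\<in>{R \<in> closed_rectangles. x \<in> R}. abs_avg f R)"

text \<open>The maximal functions of a bounded function are finite everywhere, so \<^const>\<open>enn2real\<close>
  loses no information on them.\<close>

lemma abs_avg_le:
  assumes "\<And>x. \<bar>f x\<bar> \<le> B" and "A \<in> sets lebesgue"
    and "emeasure lebesgue A \<noteq> 0" and "emeasure lebesgue A \<noteq> \<infinity>"
  shows "abs_avg f A \<le> ennreal B"
proof -
  have "(\<integral>\<^sup>+x\<in>A. ennreal \<bar>f x\<bar> \<partial>lebesgue) \<le> (\<integral>\<^sup>+x\<in>A. ennreal B \<partial>lebesgue)"
    by (intro nn_integral_mono mult_right_mono ennreal_leI assms(1)) simp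
  also have "\<dots> = ennreal B * emeasure lebesgue A"
    using assms(2) by (simp add: nn_integral_cmult_indicator)
  finally have "abs_avg f A \<le> ennreal B * emeasure lebesgue A / emeasure lebesgue A"
    unfolding abs_avg_def by (rule divide_right_mono_ennreal)
  also have "\<dots> = ennreal B"
    using assms(3,4) by (simp add: ennreal_mult_divide_eq)
  finally show ?thesis .
qed

lemma max_e1_finite:
  assumes "bounded (range f)"
  shows "max_e1 f x < \<infinity>"
proof -
  obtain B where B: "\<And>y. \<bar>f y\<bar> \<le> B"
    using assms by (auto simp: bounded_iff)
  have "max_e1 f x \<le> ennreal B"
    unfolding max_e1_def closed_intervals_def
    by (intro SUP_least, clarsimp) (rule abs_avg_le[OF B]; simp)
  then show ?thesis
    using le_less_trans[OF _ ennreal_less_top] by simp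
qed

lemma strong_max_finite:
  assumes "bounded (range f)"
  shows "strong_max f x < \<infinity>"
proof -
  obtain B where B: "\<And>y. \<bar>f y\<bar> \<le> B"
    using assms by (auto simp: bounded_iff)
  have "abs_avg f ({a..b} \<times> {c..d}) \<le> ennreal B" if "a < b" "c < d" for a b c d :: real
  proof (rule abs_avg_le[OF B])
    have eq: "{a..b} \<times> {c..d} = cbox (a, c) (b, d)"
      using cbox_Pair_eq[of a c b d] unfolding cbox_interval[of a b] cbox_interval[of c d] by (rule sym)
    show "{a..b} \<times> {c..d} \<in> sets lebesgue"
      unfolding eq by simp
    have "emeasure lebesgue ({a..b} \<times> {c..d}) = ennreal ((b - a) * (d - c))"
      using that unfolding eq
      by (simp add: emeasure_lborel_cbox_eq Basis_prod_def sum.union_disjoint prod.union_disjoint)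
    then show "emeasure lebesgue ({a..b} \<times> {c..d}) \<noteq> 0"
      "emeasure lebesgue ({a..b} \<times> {c..d}) \<noteq> \<infinity>"
      using that by auto
  qed
  then have "strong_max f x \<le> ennreal B"
    unfolding strong_max_def closed_rectangles_def by (intro SUP_least) auto
  then show ?thesis
    using le_less_trans[OF _ ennreal_less_top] by simp
qed

end

theory Submission
  imports Defs "HOL-Real_Asymp.Real_Asymp"
begin

text \<open>
  The functions are \<open>G N (x1, x2) = u (x2 - y x1)\<close>, where \<open>u s = log\<^sup>+ (1 / \<bar>s\<bar>)\<close> truncated at height
  \<open>N\<close>, and the curve \<open>y t = sin (\<epsilon> log (1 + \<bar>t\<bar>))\<close> with \<open>\<epsilon> = exp (- N) / 2\<close> sweeps \<open>[- 1, 1]\<close> again and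
  again, more and more slowly.

  The BMO norms stay bounded because a truncated logarithm has bounded mean oscillation on the line
  (lemma \<open>capped_log_oscillation\<close>) and \<open>y\<close> is 1-Lipschitz: over the base of a square of side \<open>l\<close> the
  singularity moves by at most \<open>l\<close>, so all vertical slices of \<open>G N\<close> over the square are slices of \<open>u\<close>
  inside one common interval of length \<open>3 l\<close>.

  The maximal functions look at scales where this control is useless, because the horizontal side of
  an interval or rectangle may be enormous. Every height \<open>x2\<close> in \<open>[0, 1]\<close> is attained by \<open>y\<close> at some
  large \<open>T\<close>, and a change of \<open>t\<close> by a factor \<open>2\<close> changes \<open>log (1 + t)\<close> by at most \<open>1\<close>. Hence \<open>y\<close> stays
  within \<open>exp (- N)\<close> of \<open>x2\<close> throughout \<open>[T, 2 T]\<close> (lemma \<open>drift_lingers\<close>), and there \<open>G N = N\<close> at height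
  \<open>x2\<close>. Averaging over \<open>[0, 2 T]\<close> gives \<open>max_e1 (G N) \<ge> N / 2\<close> on \<open>[0, 4] \<times> [0, 1]\<close>, and a very thin
  rectangle gives the same for the strong maximal function.

  At heights \<open>x2 \<ge> 3\<close> nothing is seen. On horizontal lines \<open>G N\<close> vanishes there, and a rectangle that
  reaches both height \<open>3\<close> and the strip \<open>x2 < 2\<close> containing the support has height at least \<open>1\<close>, so the
  average over it is at most \<open>\<integral> u \<le> 2\<close>. Each maximal function therefore jumps from at most \<open>2\<close> to at
  least \<open>N / 2\<close> between two parts of \<open>[0, 4] \<times> [0, 4]\<close> of fixed proportion, and its mean oscillation on that
  square grows linearly in \<open>N\<close>.
\<close>

section \<open>Averages and mean oscillation\<close>

lemma avg_diff_le:
  assumes f: "f \<in> borel_measurable lebesgue" "\<And>x. \<bar>f x\<bar> \<le> B"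
    and A: "A \<in> sets lebesgue" "emeasure lebesgue A \<noteq> 0" "emeasure lebesgue A \<noteq> \<infinity>"
  shows "ennreal \<bar>avg f A - c\<bar> \<le> abs_avg (\<lambda>x. f x - c) A"
proof -
  define m where "m = measure lebesgue A"
  have m1: "emeasure lebesgue A = ennreal m"
    unfolding m_def using A by (intro emeasure_eq_ennreal_measure) auto
  moreover have "m \<noteq> 0" using A(2) unfolding m1 by auto
  then have "m > 0" using measure_nonneg[of lebesgue A] unfolding m_def by linarith
  ultimately have m: "emeasure lebesgue A = ennreal m" "m > 0" by auto
  have int: "set_integrable lebesgue A g" if "g \<in> borel_measurable lebesgue" "\<And>x. \<bar>g x\<bar> \<le> C" for g and C :: real
    unfolding set_integrable_def
  proof (rule integrableI_bounded_set_indicator[where B = C])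
    show "A \<in> sets lebesgue" "g \<in> borel_measurable lebesgue" "emeasure lebesgue A < \<infinity>"
      using that A by (auto simp: less_top)
  qed (use that in auto)
  have i1: "set_integrable lebesgue A f" using int f by blast
  have i2: "set_integrable lebesgue A (\<lambda>x. c)" by (rule int[of _ "\<bar>c\<bar>"]) auto
  have i3: "set_integrable lebesgue A (\<lambda>x. f x - c)" using i1 i2 by (rule set_integral_diff)
  have "(LINT x:A|lebesgue. c) = m * c"
    using A by (simp add: set_lebesgue_integral_def m_def)
  then have "(LINT x:A|lebesgue. f x - c) = (LINT x:A|lebesgue. f x) - m * c"
    using set_integral_diff(2)[OF i1 i2] by simp
  then have "m * \<bar>avg f A - c\<bar> = \<bar>LINT x:A|lebesgue. f x - c\<bar>"
    using m by (simp add: avg_def m_def[symmetric] field_simps abs_mult[symmetric] abs_of_pos)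
  then have "ennreal m * ennreal \<bar>avg f A - c\<bar> = ennreal \<bar>LINT x:A|lebesgue. f x - c\<bar>"
    using m by (simp flip: ennreal_mult)
  also have "\<dots> \<le> (\<integral>\<^sup>+x. ennreal \<bar>indicator A x * (f x - c)\<bar> \<partial>lebesgue)"
    using integral_norm_bound_ennreal[OF i3[unfolded set_integrable_def]]
    by (simp add: set_lebesgue_integral_def)
  also have "\<dots> = (\<integral>\<^sup>+x\<in>A. ennreal \<bar>f x - c\<bar> \<partial>lebesgue)"
    by (intro nn_integral_cong) (auto split: split_indicator)
  finally have "ennreal \<bar>avg f A - c\<bar> * ennreal m / ennreal m \<le> abs_avg (\<lambda>x. f x - c) A"
    unfolding abs_avg_def m(1) by (intro divide_right_mono_ennreal) (simp add: mult.commute)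
  then show ?thesis using m(2) by (simp add: ennreal_mult_divide_eq)
qed

text \<open>
  The mean oscillation is comparable with the oscillation about the best constant, so in upper bounds
  the average may be replaced by any convenient value.
\<close>

lemma mean_osc_le:
  assumes f: "f \<in> borel_measurable lebesgue" "\<And>x. \<bar>f x\<bar> \<le> B"
    and A: "A \<in> sets lebesgue" "emeasure lebesgue A \<noteq> 0" "emeasure lebesgue A \<noteq> \<infinity>"
  shows "mean_osc f A \<le> 2 * abs_avg (\<lambda>x. f x - c) A"
proof -
  have "(\<integral>\<^sup>+x\<in>A. ennreal \<bar>f x - avg f A\<bar> \<partial>lebesgue)
      \<le> (\<integral>\<^sup>+x. ennreal \<bar>f x - c\<bar> * indicator A x + ennreal \<bar>avg f A - c\<bar> * indicator A x \<partial>lebesgue)"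
    by (intro nn_integral_mono)
       (auto split: split_indicator simp flip: ennreal_plus intro!: ennreal_leI)
  also have "\<dots> = (\<integral>\<^sup>+x\<in>A. ennreal \<bar>f x - c\<bar> \<partial>lebesgue) + ennreal \<bar>avg f A - c\<bar> * emeasure lebesgue A"
    using f A by (subst nn_integral_add) (auto simp: nn_integral_cmult_indicator)
  finally have "mean_osc f A \<le> ((\<integral>\<^sup>+x\<in>A. ennreal \<bar>f x - c\<bar> \<partial>lebesgue)
      + ennreal \<bar>avg f A - c\<bar> * emeasure lebesgue A) / emeasure lebesgue A"
    unfolding mean_osc_def abs_avg_def by (rule divide_right_mono_ennreal)
  also have "\<dots> = abs_avg (\<lambda>x. f x - c) A + ennreal \<bar>avg f A - c\<bar>"
    using A by (simp add: add_divide_distrib_ennreal abs_avg_def ennreal_mult_divide_eq)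
  also have "\<dots> \<le> abs_avg (\<lambda>x. f x - c) A + abs_avg (\<lambda>x. f x - c) A"
    using avg_diff_le[OF assms] by (rule add_left_mono)
  finally show ?thesis by (simp add: mult_2)
qed

lemma abs_avg_ge_half:
  assumes "\<And>x. x \<in> B \<Longrightarrow> K \<le> \<bar>f x\<bar>" "B \<subseteq> A" "B \<in> sets lebesgue"
    and "emeasure lebesgue A = ennreal (2 * m)" "emeasure lebesgue B = ennreal m" "m > 0"
    and "0 \<le> K"
  shows "ennreal (K / 2) \<le> abs_avg f A"
proof -
  have "ennreal (K * m) = (\<integral>\<^sup>+x\<in>B. ennreal K \<partial>lebesgue)"
    using assms by (simp add: nn_integral_cmult_indicator ennreal_mult)
  also have "\<dots> \<le> (\<integral>\<^sup>+x\<in>A. ennreal \<bar>f x\<bar> \<partial>lebesgue)"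
    using assms(1,2) by (intro nn_integral_mono) (auto split: split_indicator intro!: ennreal_leI)
  finally have "ennreal (K * m) / ennreal (2 * m) \<le> abs_avg f A"
    unfolding abs_avg_def assms(4) by (rule divide_right_mono_ennreal)
  then show ?thesis
    using assms(6,7) by (simp add: divide_ennreal)
qed

lemma emeasure_lebesgue_rectangle:
  fixes a b c d :: real
  assumes "a \<le> b" "c \<le> d"
  shows "emeasure lebesgue ({a..b} \<times> {c..d}) = ennreal ((b - a) * (d - c))"
proof -
  have eq: "{a..b} \<times> {c..d} = cbox (a, c) (b, d)"
    using cbox_Pair_eq[of a c b d] unfolding cbox_interval[of a b] cbox_interval[of c d] by (rule sym)
  show ?thesis
    using assms unfolding eq
    by (simp add: emeasure_lborel_cbox_eq Basis_prod_def sum.union_disjoint prod.union_disjoint)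
qed

lemma rectangle_lebesgue_measurable [measurable]:
  fixes a b c d :: real
  shows "{a..b} \<times> {c..d} \<in> sets lebesgue"
  by (intro sets_completionI_sets) (auto intro: borel_closed closed_Times)

lemma nn_integral_rectangle:
  fixes f :: "real \<times> real \<Rightarrow> ennreal"
  assumes [measurable]: "f \<in> borel_measurable borel"
  shows "(\<integral>\<^sup>+x\<in>{a..b} \<times> {c..d}. f x \<partial>lebesgue)
       = (\<integral>\<^sup>+t\<in>{a..b}. (\<integral>\<^sup>+s\<in>{c..d}. f (t, s) \<partial>lborel) \<partial>lborel)"
proof -
  have [measurable]: "f \<in> borel_measurable (lborel \<Otimes>\<^sub>M lborel)"
    by (simp add: lborel_prod)
  have "(\<integral>\<^sup>+x\<in>{a..b} \<times> {c..d}. f x \<partial>lebesgue)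
      = (\<integral>\<^sup>+x. f x * indicator ({a..b} \<times> {c..d}) x \<partial>(lborel \<Otimes>\<^sub>M lborel))"
    by (simp add: nn_integral_completion lborel_prod)
  also have "\<dots> = (\<integral>\<^sup>+t. \<integral>\<^sup>+s. f (t, s) * indicator ({a..b} \<times> {c..d}) (t, s) \<partial>lborel \<partial>lborel)"
    by (rule lborel.nn_integral_fst[symmetric]) measurable
  also have "\<dots> = (\<integral>\<^sup>+t. \<integral>\<^sup>+s. (f (t, s) * indicator {c..d} s) * indicator {a..b} t \<partial>lborel \<partial>lborel)"
    by (simp add: indicator_times mult_ac)
  also have "\<dots> = (\<integral>\<^sup>+t\<in>{a..b}. (\<integral>\<^sup>+s\<in>{c..d}. f (t, s) \<partial>lborel) \<partial>lborel)"
    by (subst nn_integral_multc) auto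
  finally show ?thesis .
qed

text \<open>
  Integrating vertical slices first reduces averages over rectangles to a bound in one variable that is
  uniform in the slice.
\<close>

lemma abs_avg_rectangle_le:
  fixes f :: "real \<times> real \<Rightarrow> real"
  assumes f: "f \<in> borel_measurable borel" and "a < b" "c < d" "0 \<le> K"
    and col: "\<And>t. t \<in> {a..b} \<Longrightarrow> (\<integral>\<^sup>+s\<in>{c..d}. ennreal \<bar>f (t, s)\<bar> \<partial>lborel) \<le> ennreal (K * (d - c))"
  shows "abs_avg f ({a..b} \<times> {c..d}) \<le> ennreal K"
proof -
  have "(\<integral>\<^sup>+x\<in>{a..b} \<times> {c..d}. ennreal \<bar>f x\<bar> \<partial>lebesgue)
      = (\<integral>\<^sup>+t\<in>{a..b}. (\<integral>\<^sup>+s\<in>{c..d}. ennreal \<bar>f (t, s)\<bar> \<partial>lborel) \<partial>lborel)"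
    using f by (intro nn_integral_rectangle[of "\<lambda>x. ennreal \<bar>f x\<bar>"]) simp
  also have "\<dots> \<le> (\<integral>\<^sup>+t\<in>{a..b}. ennreal (K * (d - c)) \<partial>lborel)"
    using col by (intro nn_integral_mono) (auto split: split_indicator)
  also have "\<dots> = ennreal (K * ((b - a) * (d - c)))"
    using assms by (subst nn_integral_cmult_indicator) (simp_all add: mult_ac flip: ennreal_mult)
  finally have "abs_avg f ({a..b} \<times> {c..d})
      \<le> ennreal (K * ((b - a) * (d - c))) / ennreal ((b - a) * (d - c))"
    using assms emeasure_lebesgue_rectangle[of a b c d]
    by (simp add: abs_avg_def divide_right_mono_ennreal)
  also have "\<dots> = ennreal K"
    using assms by (simp add: divide_ennreal)
  finally show ?thesis .
qed

section \<open>The truncated logarithm on the line\<close>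

text \<open>
  The total size of a logarithmic singularity is proportional to the length scale \<open>r\<close> at which it is
  cut off; this scaling is what makes the logarithm a BMO function.
\<close>

lemma nn_integral_log_singularity:
  fixes r :: real
  assumes "r > 0"
  shows "(\<integral>\<^sup>+s. ennreal (max 0 (ln (r / \<bar>s\<bar>))) \<partial>lborel) = ennreal (2 * r)"
proof -
  \<comment> \<open>A primitive of \<open>ln (r / \<bar>s\<bar>)\<close> that stays continuous at the exceptional point \<open>0\<close>.\<close>
  define F where "F s = s * (ln r - ln \<bar>s\<bar>) + s" for s :: real
  have der: "(F has_real_derivative ln (r / \<bar>s\<bar>)) (at s)" if "s \<noteq> 0" for s
  proof (cases "s > 0")
    case True
    have "((\<lambda>s. s * (ln r - ln s) + s) has_real_derivative ln (r / \<bar>s\<bar>)) (at s)"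
      using True assms by (auto intro!: derivative_eq_intros simp: ln_div field_simps)
    moreover have "\<forall>\<^sub>F t in nhds s. F t = t * (ln r - ln t) + t"
      using eventually_nhds_in_open[of "{0<..}" s] True
      by (auto elim!: eventually_mono simp: F_def)
    ultimately show ?thesis
      by (subst DERIV_cong_ev[OF refl _ refl]) auto
  next
    case False
    then have "s < 0" using that by simp
    have "((\<lambda>s. s * (ln r - ln (- s)) + s) has_real_derivative ln (r / \<bar>s\<bar>)) (at s)"
      using \<open>s < 0\<close> assms ln_div[of r "- s"] by (auto intro!: derivative_eq_intros)
    moreover have "\<forall>\<^sub>F t in nhds s. F t = t * (ln r - ln (- t)) + t"
      using eventually_nhds_in_open[of "{..<0}" s] \<open>s < 0\<close>
      by (auto elim!: eventually_mono simp: F_def)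
    ultimately show ?thesis
      by (subst DERIV_cong_ev[OF refl _ refl]) auto
  qed
  have "((\<lambda>s::real. s * ln \<bar>s\<bar>) \<longlongrightarrow> 0) (at 0)"
    unfolding filterlim_at_split by (safe; real_asymp)
  then have "((\<lambda>s. s * ln r - s * ln \<bar>s\<bar> + s) \<longlongrightarrow> 0 * ln r - 0 + 0) (at 0)"
    by (intro tendsto_intros)
  moreover have "(\<lambda>s. s * ln r - s * ln \<bar>s\<bar> + s) = F"
    by (simp add: fun_eq_iff F_def algebra_simps)
  ultimately have "isCont F 0"
    by (simp add: isCont_def F_def)
  then have "isCont F s" for s
    using der DERIV_isCont by (cases "s = 0") auto
  then have "continuous_on {- r..r} F"
    by (intro continuous_at_imp_continuous_on) auto
  then have "((\<lambda>s. ln (r / \<bar>s\<bar>)) has_integral (F r - F (- r))) {- r..r}"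
    using assms der
    by (intro fundamental_theorem_of_calculus_interior_strong[of "{0}"])
       (auto simp: has_real_derivative_iff_has_vector_derivative)
  then have "((\<lambda>s. if s \<in> {- r..r} then ln (r / \<bar>s\<bar>) else 0) has_integral (2 * r)) UNIV"
    unfolding has_integral_restrict_UNIV using assms by (simp add: F_def)
  moreover have "(\<lambda>s. if s \<in> {- r..r} then ln (r / \<bar>s\<bar>) else 0) = (\<lambda>s. max 0 (ln (r / \<bar>s\<bar>)))"
    using assms
    by (auto simp: fun_eq_iff max_def ln_div abs_le_iff)
  ultimately show ?thesis
    by (intro nn_integral_has_integral_lborel) auto
qed

text \<open>
  This is \<open>log\<^sup>+ (1 / \<bar>s\<bar>)\<close> truncated at height \<open>N\<close>. The truncation is done inside the logarithm so that
  the value at \<open>0\<close> is \<open>N\<close> and the function is continuous.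
\<close>

definition capped_log :: "nat \<Rightarrow> real \<Rightarrow> real" where
  "capped_log N s = - ln (min 1 (max (exp (- real N)) \<bar>s\<bar>))"

lemma capped_log_eq:
  assumes "s \<noteq> 0"
  shows "capped_log N s = max 0 (min (real N) (- ln \<bar>s\<bar>))"
proof -
  have "ln (min 1 (max (exp (- real N)) \<bar>s\<bar>)) = min 0 (max (- real N) (ln \<bar>s\<bar>))"
    using assms by (auto simp: min_def max_def ln_ge_iff ln_le_zero_iff)
  then show ?thesis
    by (simp add: capped_log_def min_def max_def)
qed

lemma capped_log_bounds: "0 \<le> capped_log N s" "capped_log N s \<le> real N"
proof -
  have "0 < min 1 (max (exp (- real N)) \<bar>s\<bar>)" "exp (- real N) \<le> min 1 (max (exp (- real N)) \<bar>s\<bar>)"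
    by (auto simp: less_max_iff_disj)
  then show "0 \<le> capped_log N s" "capped_log N s \<le> real N"
    unfolding capped_log_def using ln_ge_iff[of "min 1 (max (exp (- real N)) \<bar>s\<bar>)" "- real N"] by auto
qed

lemma capped_log_eq_cap: "\<bar>s\<bar> \<le> exp (- real N) \<Longrightarrow> capped_log N s = real N"
  by (simp add: capped_log_def max_absorb1 min_absorb2)

lemma capped_log_eq_0: "1 \<le> \<bar>s\<bar> \<Longrightarrow> capped_log N s = 0"
  by (simp add: capped_log_def)

lemma continuous_on_capped_log: "continuous_on UNIV (capped_log N)"
  unfolding capped_log_def
  by (intro continuous_intros) (auto simp: min_def max_def)

lemma borel_measurable_capped_log [measurable]: "capped_log N \<in> borel_measurable borel"
  by (rule borel_measurable_continuous_onI) (rule continuous_on_capped_log)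

text \<open>
  Truncation from above and below is 1-Lipschitz, so the oscillation of the capped logarithm is
  dominated by that of the logarithm itself, independently of \<open>N\<close>.
\<close>

lemma capped_log_diff_le:
  assumes "s \<noteq> 0" "r > 0"
  shows "\<bar>capped_log N s - capped_log N r\<bar> \<le> \<bar>ln (r / \<bar>s\<bar>)\<bar>"
  using assms by (simp add: capped_log_eq ln_div) linarith

text \<open>
  The logarithm is BMO on the line. An interval close to the origin compared with its length lies in
  \<open>[- 2 L, 2 L]\<close>, where the deviation from the value at \<open>2 L\<close> is the log singularity at scale \<open>2 L\<close>. On
  an interval far from the origin \<open>\<bar>s\<bar>\<close> varies by a factor at most \<open>2\<close>, hence the logarithm by at most
  \<open>ln 2\<close>.
\<close>

lemma capped_log_oscillation:
  assumes "L > 0"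
  shows "\<exists>c. (\<integral>\<^sup>+s\<in>{p..p + L}. ennreal \<bar>capped_log N s - c\<bar> \<partial>lborel) \<le> ennreal (4 * L)"
proof (cases "\<exists>s\<in>{p..p + L}. \<bar>s\<bar> \<le> L")
  case True
  let ?r = "2 * L"
  have "(\<integral>\<^sup>+s\<in>{p..p + L}. ennreal \<bar>capped_log N s - capped_log N ?r\<bar> \<partial>lborel)
      \<le> (\<integral>\<^sup>+s. ennreal (max 0 (ln (?r / \<bar>s\<bar>))) \<partial>lborel)"
  proof (rule nn_integral_mono_AE)
    show "AE s in lborel. ennreal \<bar>capped_log N s - capped_log N ?r\<bar> * indicator {p..p + L} s
        \<le> ennreal (max 0 (ln (?r / \<bar>s\<bar>)))"
      using AE_lborel_singleton[of "0::real"]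
    proof eventually_elim
      case (elim s)
      show ?case
      proof (cases "s \<in> {p..p + L}")
        case in_ival: True
        then have "\<bar>s\<bar> \<le> ?r" using True by auto
        then have "0 \<le> ln (?r / \<bar>s\<bar>)" using elim assms by simp
        then show ?thesis
          using capped_log_diff_le[OF elim, of ?r N] assms in_ival by (auto intro!: ennreal_leI)
      qed simp
    qed
  qed
  also have "\<dots> = ennreal (4 * L)"
    using assms by (simp add: nn_integral_log_singularity)
  finally show ?thesis by blast
next
  case False
  define m where "m = min \<bar>p\<bar> \<bar>p + L\<bar>"
  have "p > L \<or> p + L < - L"
    using False assms by (smt (verit) atLeastAtMost_iff)
  then have m: "m > L" "\<And>s. s \<in> {p..p + L} \<Longrightarrow> m \<le> \<bar>s\<bar> \<and> \<bar>s\<bar> \<le> 2 * m"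
    using assms by (auto simp: m_def)
  have *: "\<bar>capped_log N s - capped_log N m\<bar> \<le> 1" if "s \<in> {p..p + L}" for s
  proof -
    have s: "s \<noteq> 0" "m \<le> \<bar>s\<bar>" "\<bar>s\<bar> \<le> 2 * m" using m that assms by fastforce+
    then have "ln m \<le> ln \<bar>s\<bar>" "ln \<bar>s\<bar> \<le> ln (2 * m)"
      using m assms by auto
    moreover have "ln (2 * m) = ln 2 + ln m" using m assms by (simp add: ln_mult)
    moreover have "ln (m / \<bar>s\<bar>) = ln m - ln \<bar>s\<bar>"
      using s m(1) assms by (simp add: ln_div)
    ultimately have "\<bar>ln (m / \<bar>s\<bar>)\<bar> \<le> ln 2" by linarith
    also have "\<dots> \<le> 1" using ln_le_minus_one[of 2] by simp
    finally show ?thesis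
      using capped_log_diff_le[OF s(1), of m N] m assms by simp
  qed
  have "(\<integral>\<^sup>+s\<in>{p..p + L}. ennreal \<bar>capped_log N s - capped_log N m\<bar> \<partial>lborel)
      \<le> (\<integral>\<^sup>+s\<in>{p..p + L}. 1 \<partial>lborel)"
    using * by (intro nn_integral_mono) (auto split: split_indicator)
  also have "\<dots> \<le> ennreal (4 * L)"
    using assms by (auto intro!: ennreal_leI)
  finally show ?thesis by blast
qed

lemma nn_integral_capped_log_le: "(\<integral>\<^sup>+s. ennreal (capped_log N s) \<partial>lborel) \<le> 2"
proof -
  have "(\<integral>\<^sup>+s. ennreal (capped_log N s) \<partial>lborel)
      \<le> (\<integral>\<^sup>+s. ennreal (max 0 (ln (1 / \<bar>s\<bar>))) \<partial>lborel)"
    by (intro nn_integral_mono_AE, use AE_lborel_singleton[of "0::real"] in eventually_elim)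
       (auto intro!: ennreal_leI simp: capped_log_eq ln_div)
  then show ?thesis by (simp add: nn_integral_log_singularity)
qed

section \<open>A slowly oscillating curve\<close>

definition drift :: "nat \<Rightarrow> real \<Rightarrow> real" where
  "drift N t = sin (exp (- real N) / 2 * ln (1 + \<bar>t\<bar>))"

lemma abs_sin_diff_le: "\<bar>sin a - sin b\<bar> \<le> \<bar>a - b\<bar>" for a b :: real
proof -
  have "\<bar>sin a - sin b\<bar> = 2 * \<bar>sin ((a - b) / 2)\<bar> * \<bar>cos ((a + b) / 2)\<bar>"
    by (simp add: sin_diff_sin abs_mult)
  also have "\<dots> \<le> 2 * \<bar>(a - b) / 2\<bar> * 1"
    using abs_sin_x_le_abs_x[of "(a - b) / 2"] by (intro mult_mono) auto
  finally show ?thesis by simp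
qed

text \<open>
  The derivative of \<open>ln (1 + t)\<close> on \<open>[s, t]\<close> is at most \<open>1 / (1 + s)\<close>. The denominator \<open>1 + s\<close>
  matters on dyadic blocks: for \<open>t \<le> 2 s\<close> the curve moves by at most \<open>exp (- N) / 2\<close>, however large
  \<open>s\<close> is.
\<close>

lemma drift_diff_le:
  assumes "0 \<le> s" "s \<le> t"
  shows "\<bar>drift N t - drift N s\<bar> \<le> exp (- real N) / 2 * ((t - s) / (1 + s))"
proof -
  have "ln (1 + t) - ln (1 + s) = ln (1 + (t - s) / (1 + s))"
    using assms ln_div[of "1 + t" "1 + s"] by (simp add: field_simps)
  also have "\<dots> \<le> (t - s) / (1 + s)"
    using assms by (intro ln_add_one_self_le_self) auto
  finally have "ln (1 + t) - ln (1 + s) \<le> (t - s) / (1 + s)" .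
  moreover have "ln (1 + s) \<le> ln (1 + t)" using assms by simp
  ultimately have "\<bar>ln (1 + t) - ln (1 + s)\<bar> \<le> (t - s) / (1 + s)" by simp
  then have "exp (- real N) / 2 * \<bar>ln (1 + t) - ln (1 + s)\<bar> \<le> exp (- real N) / 2 * ((t - s) / (1 + s))"
    by (intro mult_left_mono) auto
  moreover have "\<bar>drift N t - drift N s\<bar> \<le> \<bar>exp (- real N) / 2 * ln (1 + t) - exp (- real N) / 2 * ln (1 + s)\<bar>"
    using abs_sin_diff_le[of "exp (- real N) / 2 * ln (1 + t)" "exp (- real N) / 2 * ln (1 + s)"] assms
    by (simp add: drift_def)
  moreover have "\<dots> = exp (- real N) / 2 * \<bar>ln (1 + t) - ln (1 + s)\<bar>"
    by (simp add: abs_mult flip: right_diff_distrib diff_divide_distrib)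
  ultimately show ?thesis by linarith
qed

lemma drift_Lipschitz: "\<bar>drift N t - drift N s\<bar> \<le> \<bar>t - s\<bar>"
proof -
  have *: "\<bar>drift N q - drift N p\<bar> \<le> q - p" if "0 \<le> p" "p \<le> q" for p q
  proof -
    have "exp (- real N) / 2 * ((q - p) / (1 + p)) \<le> 1 * ((q - p) / 1)"
      using that by (intro mult_mono divide_left_mono) (auto intro: order_trans[of _ 1])
    then show ?thesis using drift_diff_le[OF that, of N] by simp
  qed
  have "\<bar>drift N \<bar>t\<bar> - drift N \<bar>s\<bar>\<bar> \<le> \<bar>\<bar>t\<bar> - \<bar>s\<bar>\<bar>"
    using *[of "\<bar>s\<bar>" "\<bar>t\<bar>"] *[of "\<bar>t\<bar>" "\<bar>s\<bar>"] by (cases "\<bar>s\<bar> \<le> \<bar>t\<bar>") (auto simp: abs_minus_commute)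
  also have "\<dots> \<le> \<bar>t - s\<bar>" by simp
  finally show ?thesis by (simp add: drift_def)
qed

text \<open>
  The curve returns to every height in \<open>[- 1, 1]\<close> at arbitrarily large times, and near a large time \<open>T\<close>
  it remains there over a whole dyadic block. The bound \<open>4 \<le> T\<close> makes \<open>[0, 2 T]\<close> contain the base
  \<open>[0, 4]\<close> of the square on which the oscillation is measured.
\<close>

lemma drift_lingers:
  assumes "- 1 \<le> x" "x \<le> 1"
  shows "\<exists>T\<ge>4. \<forall>t\<in>{T..2 * T}. \<bar>drift N t - x\<bar> \<le> exp (- real N) / 2"
proof -
  define \<epsilon> where "\<epsilon> = exp (- real N) / 2"
  \<comment> \<open>One full turn is added so that the phase is positive and \<open>T = exp \<theta> - 1\<close> is large.\<close>
  define \<theta> where "\<theta> = (arcsin x + 2 * pi) / \<epsilon>"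
  have \<epsilon>: "0 < \<epsilon>" "\<epsilon> \<le> 1 / 2" by (auto simp: \<epsilon>_def)
  have *: "4 \<le> arcsin x + 2 * pi"
    using arcsin_lbound[of x] assms pi_gt3 by simp
  also have "arcsin x + 2 * pi = \<theta> * \<epsilon>" using \<epsilon> by (simp add: \<theta>_def)
  also have "\<dots> \<le> \<theta> * 1"
    using \<epsilon> * by (intro mult_left_mono) (auto simp: \<theta>_def)
  finally have "4 \<le> \<theta>" by simp
  define T where "T = exp \<theta> - 1"
  have T: "T \<ge> 4" using exp_ge_add_one_self[of \<theta>] \<open>4 \<le> \<theta>\<close> unfolding T_def by linarith
  have "drift N T = x"
  proof -
    have "drift N T = sin (\<epsilon> * ln (exp \<theta>))"
    proof -
      have "1 + \<bar>T\<bar> = exp \<theta>" using T by (simp add: T_def)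
      then show ?thesis by (simp add: drift_def \<epsilon>_def)
    qed
    also have "\<epsilon> * ln (exp \<theta>) = arcsin x + 2 * pi"
      using \<epsilon> by (simp add: \<theta>_def)
    finally show ?thesis using assms by simp
  qed
  moreover have "\<bar>drift N t - drift N T\<bar> \<le> \<epsilon>" if "t \<in> {T..2 * T}" for t
  proof -
    have "\<bar>drift N t - drift N T\<bar> \<le> \<epsilon> * ((t - T) / (1 + T))"
      using drift_diff_le[of T t N] T that by (simp add: \<epsilon>_def)
    also have "\<dots> \<le> \<epsilon> * 1"
      using T \<epsilon> that by (intro mult_left_mono) (auto simp: field_simps)
    finally show ?thesis by simp
  qed
  ultimately show ?thesis using T by (auto simp: \<epsilon>_def)
qed

section \<open>The logarithm sheared along the curve\<close>

definition drifting_log :: "nat \<Rightarrow> real \<times> real \<Rightarrow> real" where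
  "drifting_log N x = capped_log N (snd x - drift N (fst x))"

lemma drifting_log_bounds: "0 \<le> drifting_log N x" "drifting_log N x \<le> real N"
  by (simp_all add: drifting_log_def capped_log_bounds)

lemma borel_measurable_drifting_log [measurable]: "drifting_log N \<in> borel_measurable borel"
proof -
  have "continuous_on UNIV (\<lambda>x :: real \<times> real. snd x - drift N (fst x))"
    unfolding drift_def by (intro continuous_intros) (auto simp: add_pos_nonneg add_nonneg_eq_0_iff)
  then have "continuous_on UNIV (\<lambda>x. capped_log N (snd x - drift N (fst x)))"
    by (rule continuous_on_compose2[OF continuous_on_capped_log]) auto
  then show ?thesis
    unfolding drifting_log_def[abs_def] by (rule borel_measurable_continuous_onI)
qed

lemma nn_integral_lborel_shift:
  fixes f :: "real \<Rightarrow> ennreal"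
  assumes "f \<in> borel_measurable borel"
  shows "(\<integral>\<^sup>+s. f (s - z) \<partial>lborel) = (\<integral>\<^sup>+s. f s \<partial>lborel)"
  using nn_integral_real_affine[OF assms, of 1 "- z"] by (simp add: add.commute)

text \<open>
  A square of side \<open>l\<close> meets the sheared logarithm in vertical slices whose arguments
  \<open>x2 - drift N x1\<close> all lie in one interval of length \<open>3 l\<close>: the side of the square plus the movement of
  the curve by at most \<open>l\<close> in either direction. One constant thus serves all slices.
\<close>

lemma bmo_norm_drifting_log_le: "bmo_norm (drifting_log N) \<le> 24"
  unfolding bmo_norm_def
proof (rule SUP_least)
  fix Q assume "Q \<in> closed_squares"
  then obtain a b l where Q: "Q = {a..a + l} \<times> {b..b + l}" and l: "l > 0"
    by (auto simp: closed_squares_def)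
  define p where "p = b - drift N a - l"
  obtain c where c: "(\<integral>\<^sup>+s\<in>{p..p + 3 * l}. ennreal \<bar>capped_log N s - c\<bar> \<partial>lborel) \<le> ennreal (4 * (3 * l))"
    using capped_log_oscillation[of "3 * l"] l by auto
  have "abs_avg (\<lambda>x. drifting_log N x - c) Q \<le> ennreal 12"
    unfolding Q
  proof (rule abs_avg_rectangle_le)
    fix t assume t: "t \<in> {a..a + l}"
    let ?g = "\<lambda>s. ennreal \<bar>capped_log N s - c\<bar> * indicator {p..p + 3 * l} s"
    have "(\<integral>\<^sup>+s\<in>{b..b + l}. ennreal \<bar>drifting_log N (t, s) - c\<bar> \<partial>lborel)
        \<le> (\<integral>\<^sup>+s. ?g (s - drift N t) \<partial>lborel)"
    proof (rule nn_integral_mono)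
      fix s
      have "s - drift N t \<in> {p..p + 3 * l}" if "s \<in> {b..b + l}"
        using drift_Lipschitz[of N t a] t that by (auto simp: p_def)
      then show "ennreal \<bar>drifting_log N (t, s) - c\<bar> * indicator {b..b + l} s \<le> ?g (s - drift N t)"
        by (cases "s \<in> {b..b + l}") (simp_all add: drifting_log_def)
    qed
    also have "\<dots> = (\<integral>\<^sup>+s. ?g s \<partial>lborel)"
      by (intro nn_integral_lborel_shift) measurable
    also have "\<dots> \<le> ennreal (12 * (b + l - b))" using c by simp
    finally show "(\<integral>\<^sup>+s\<in>{b..b + l}. ennreal \<bar>drifting_log N (t, s) - c\<bar> \<partial>lborel) \<le> ennreal (12 * (b + l - b))" .
  qed (use l in auto)
  moreover have "mean_osc (drifting_log N) Q \<le> 2 * abs_avg (\<lambda>x. drifting_log N x - c) Q"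
  proof (rule mean_osc_le)
    show "\<bar>drifting_log N x\<bar> \<le> real N" for x using drifting_log_bounds[of N x] by simp
    show "drifting_log N \<in> borel_measurable lebesgue" by (rule measurable_completion) simp
    show "Q \<in> sets lebesgue" unfolding Q by measurable
    have "emeasure lebesgue Q = ennreal (l * l)"
      unfolding Q using l by (subst emeasure_lebesgue_rectangle) auto
    then show "emeasure lebesgue Q \<noteq> 0" "emeasure lebesgue Q \<noteq> \<infinity>" using l by auto
  qed
  ultimately have "mean_osc (drifting_log N) Q \<le> 2 * ennreal 12"
    by (meson mult_left_mono order_trans zero_le)
  also have "\<dots> = 24" by (simp flip: ennreal_numeral ennreal_mult)
  finally show "mean_osc (drifting_log N) Q \<le> 24" .
qed

section \<open>Its maximal functions\<close>

text \<open>
  The tolerance \<open>exp (- N)\<close> within which the capped logarithm is at full height is shared equally by the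
  movement of the curve over \<open>[T, 2 T]\<close> and by the distance from the given height; the latter half
  leaves room for a rectangle of positive height.
\<close>

lemma drifting_log_full_height:
  assumes "x2 \<in> {0..1}"
  obtains T where "T \<ge> 4"
    and "\<And>t s. t \<in> {T..2 * T} \<Longrightarrow> \<bar>s - x2\<bar> \<le> exp (- real N) / 2 \<Longrightarrow> drifting_log N (t, s) = real N"
proof -
  obtain T where T: "T \<ge> 4" "\<And>t. t \<in> {T..2 * T} \<Longrightarrow> \<bar>drift N t - x2\<bar> \<le> exp (- real N) / 2"
    using drift_lingers[of x2 N] assms by auto
  show thesis
  proof (rule that[OF T(1)])
    fix t s assume "t \<in> {T..2 * T}" "\<bar>s - x2\<bar> \<le> exp (- real N) / 2"
    then have "\<bar>s - drift N t\<bar> \<le> exp (- real N)" using T(2)[of t] by linarith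
    then show "drifting_log N (t, s) = real N"
      by (simp add: drifting_log_def capped_log_eq_cap)
  qed
qed

lemma max_e1_drifting_log_ge:
  assumes "x \<in> {0..4} \<times> {0..1}"
  shows "ennreal (real N / 2) \<le> max_e1 (drifting_log N) x"
proof -
  obtain T where T: "T \<ge> 4"
      "\<And>t s. t \<in> {T..2 * T} \<Longrightarrow> \<bar>s - snd x\<bar> \<le> exp (- real N) / 2 \<Longrightarrow> drifting_log N (t, s) = real N"
    using drifting_log_full_height[of "snd x" N] assms by (auto simp: mem_Times_iff)
  have "ennreal (real N / 2) \<le> abs_avg (\<lambda>t. drifting_log N (t, snd x)) {0..2 * T}"
    by (rule abs_avg_ge_half[where B = "{T..2 * T}" and m = T]) (use T in auto)
  also have "\<dots> \<le> max_e1 (drifting_log N) x"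
    unfolding max_e1_def closed_intervals_def
    by (intro SUP_upper) (use T assms in \<open>auto simp: mem_Times_iff\<close>)
  finally show ?thesis .
qed

lemma strong_max_drifting_log_ge:
  assumes "x \<in> {0..4} \<times> {0..1}"
  shows "ennreal (real N / 2) \<le> strong_max (drifting_log N) x"
proof -
  define \<delta> where "\<delta> = exp (- real N) / 2"
  have \<delta>: "\<delta> > 0" by (simp add: \<delta>_def)
  obtain T where T: "T \<ge> 4"
      "\<And>t s. t \<in> {T..2 * T} \<Longrightarrow> \<bar>s - snd x\<bar> \<le> \<delta> \<Longrightarrow> drifting_log N (t, s) = real N"
    using drifting_log_full_height[of "snd x" N] assms unfolding \<delta>_def by (auto simp: mem_Times_iff)
  let ?J = "{snd x - \<delta>..snd x + \<delta>}"
  have "ennreal (real N / 2) \<le> abs_avg (drifting_log N) ({0..2 * T} \<times> ?J)"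
  proof (rule abs_avg_ge_half)
    show "real N \<le> \<bar>drifting_log N y\<bar>" if "y \<in> {T..2 * T} \<times> ?J" for y
      using T(2)[of "fst y" "snd y"] that by (auto simp: abs_le_iff)
    show "emeasure lebesgue ({0..2 * T} \<times> ?J) = ennreal (2 * (T * (2 * \<delta>)))"
      using T \<delta> by (subst emeasure_lebesgue_rectangle) (auto simp: mult_ac)
    show "emeasure lebesgue ({T..2 * T} \<times> ?J) = ennreal (T * (2 * \<delta>))"
      using T \<delta> by (subst emeasure_lebesgue_rectangle) auto
    show "{T..2 * T} \<times> ?J \<in> sets lebesgue" by measurable
  qed (use T \<delta> in auto)
  also have "\<dots> \<le> strong_max (drifting_log N) x"
  proof -
    have "x \<in> {0..2 * T} \<times> ?J"
      using T assms \<delta> by (auto simp: mem_Times_iff)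
    moreover have "{0..2 * T} \<times> ?J \<in> closed_rectangles"
      unfolding closed_rectangles_def
      by (rule CollectI, intro exI conjI, rule refl) (use T \<delta> in auto)
    ultimately show ?thesis
      unfolding strong_max_def by (intro SUP_upper) simp
  qed
  finally show ?thesis .
qed

lemma drifting_log_eq_0:
  assumes "2 \<le> s"
  shows "drifting_log N (t, s) = 0"
proof -
  have "drift N t \<le> 1" by (simp add: drift_def)
  then show ?thesis
    using assms unfolding drifting_log_def by (intro capped_log_eq_0) simp
qed

lemma max_e1_drifting_log_eq_0:
  assumes "2 \<le> snd x"
  shows "max_e1 (drifting_log N) x = 0"
  unfolding max_e1_def le_zero_eq[symmetric]
  by (rule SUP_least) (use assms in \<open>simp add: abs_avg_def drifting_log_eq_0\<close>)

text \<open>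
  A rectangle through height \<open>3\<close> either stays above the support or has height at least \<open>1\<close>, and then the
  integral of each vertical slice is bounded by that of the whole logarithmic singularity.
\<close>

lemma strong_max_drifting_log_le:
  assumes "3 \<le> snd x"
  shows "strong_max (drifting_log N) x \<le> 2"
  unfolding strong_max_def
proof (rule SUP_least)
  fix R assume "R \<in> {R \<in> closed_rectangles. x \<in> R}"
  then obtain a b c d where R: "R = {a..b} \<times> {c..d}" "a < b" "c < d" and "x \<in> R"
    by (auto simp: closed_rectangles_def)
  then have d: "3 \<le> d" using assms by (auto simp: mem_Times_iff)
  have "abs_avg (drifting_log N) R \<le> ennreal 2"
    unfolding R(1)
  proof (rule abs_avg_rectangle_le)
    fix t assume "t \<in> {a..b}"
    show "(\<integral>\<^sup>+s\<in>{c..d}. ennreal \<bar>drifting_log N (t, s)\<bar> \<partial>lborel) \<le> ennreal (2 * (d - c))"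
    proof (cases "2 \<le> c")
      case True
      then have "(\<integral>\<^sup>+s\<in>{c..d}. ennreal \<bar>drifting_log N (t, s)\<bar> \<partial>lborel) = (\<integral>\<^sup>+(s::real). 0 \<partial>lborel)"
        by (intro nn_integral_cong) (auto split: split_indicator simp: drifting_log_eq_0)
      then show ?thesis by simp
    next
      case False
      have "(\<integral>\<^sup>+s\<in>{c..d}. ennreal \<bar>drifting_log N (t, s)\<bar> \<partial>lborel)
          \<le> (\<integral>\<^sup>+s. ennreal (capped_log N (s - drift N t)) \<partial>lborel)"
        by (intro nn_integral_mono)
           (auto split: split_indicator simp: drifting_log_def capped_log_bounds)
      also have "\<dots> = (\<integral>\<^sup>+s. ennreal (capped_log N s) \<partial>lborel)"
        by (rule nn_integral_lborel_shift) measurable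
      also have "\<dots> \<le> ennreal 2" using nn_integral_capped_log_le[of N] by simp
      also have "\<dots> \<le> ennreal (2 * (d - c))" using False d by (intro ennreal_leI) simp
      finally show ?thesis .
    qed
  qed (use R in auto)
  then show "abs_avg (drifting_log N) R \<le> 2" by simp
qed

section \<open>Oscillation of the maximal functions\<close>

text \<open>
  Whatever the average over the square is, one of the two strips lies at distance at least \<open>(H - h) / 2\<close>
  from it. Comparing integrands pointwise on that strip bounds the lower integral of the oscillation
  directly, which suits a function \<open>M\<close> that is a supremum over uncountably many averages.
\<close>

lemma bmo_norm_ge_of_gap:
  fixes M :: "real \<times> real \<Rightarrow> real"
  assumes low: "\<And>x. x \<in> {0..4} \<times> {0..1} \<Longrightarrow> H \<le> M x"
    and high: "\<And>x. x \<in> {0..4} \<times> {3..4} \<Longrightarrow> M x \<le> h"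
    and "h \<le> H"
  shows "ennreal ((H - h) / 8) \<le> bmo_norm M"
proof -
  let ?Q = "{0..4::real} \<times> {0..4::real}"
  have *: "ennreal ((H - h) / 8) \<le> mean_osc M ?Q"
    if "\<And>x. x \<in> {0..4} \<times> {p..p + 1} \<Longrightarrow> (H - h) / 2 \<le> \<bar>M x - avg M ?Q\<bar>"
      "0 \<le> p" "p + 1 \<le> 4" for p :: real
  proof -
    let ?S = "{0..4::real} \<times> {p..p + 1}"
    have "ennreal ((H - h) / 2) * ennreal 4 = (\<integral>\<^sup>+x\<in>?S. ennreal ((H - h) / 2) \<partial>lebesgue)"
      using emeasure_lebesgue_rectangle[of 0 4 p "p + 1"] by (simp add: nn_integral_cmult_indicator)
    also have "\<dots> \<le> (\<integral>\<^sup>+x\<in>?Q. ennreal \<bar>M x - avg M ?Q\<bar> \<partial>lebesgue)"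
    proof (rule nn_integral_mono)
      fix x :: "real \<times> real"
      show "ennreal ((H - h) / 2) * indicator ?S x \<le> ennreal \<bar>M x - avg M ?Q\<bar> * indicator ?Q x"
      proof (cases "x \<in> ?S")
        case True
        then have "x \<in> ?Q" using that(2,3) by auto
        then show ?thesis using True that(1)[OF True] by (simp add: ennreal_leI)
      qed simp
    qed
    finally have "ennreal ((H - h) / 2) * ennreal 4 / ennreal 16 \<le> mean_osc M ?Q" (is "?lhs \<le> _")
      using emeasure_lebesgue_rectangle[of 0 4 0 4]
      by (simp add: mean_osc_def abs_avg_def divide_right_mono_ennreal)
    moreover have "?lhs = ennreal ((H - h) / 8)"
      using \<open>h \<le> H\<close> by (subst ennreal_mult[symmetric], simp, simp, subst divide_ennreal) auto
    ultimately show ?thesis by simp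
  qed
  have "ennreal ((H - h) / 8) \<le> mean_osc M ?Q"
  proof (cases "avg M ?Q \<le> (H + h) / 2")
    case True
    show ?thesis
    proof (rule *[of 0])
      fix x :: "real \<times> real" assume "x \<in> {0..4} \<times> {0..0 + 1}"
      then have "H \<le> M x" using low[of x] by simp
      then have "(H - h) / 2 \<le> M x - avg M ?Q" using True by argo
      then show "(H - h) / 2 \<le> \<bar>M x - avg M ?Q\<bar>" by (rule order_trans) simp
    qed auto
  next
    case False
    show ?thesis
    proof (rule *[of 3])
      fix x :: "real \<times> real" assume "x \<in> {0..4} \<times> {3..3 + 1}"
      then have "M x \<le> h" using high[of x] by simp
      then have "(H - h) / 2 \<le> - (M x - avg M ?Q)" using False by argo
      then show "(H - h) / 2 \<le> \<bar>M x - avg M ?Q\<bar>" by (rule order_trans) simp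
    qed auto
  qed
  also have "?Q \<in> closed_squares"
    unfolding closed_squares_def by (rule CollectI, rule exI[of _ 0], rule exI[of _ 0], rule exI[of _ 4]) simp
  then have "mean_osc M ?Q \<le> bmo_norm M"
    unfolding bmo_norm_def by (rule SUP_upper)
  finally show ?thesis .
qed

lemma bmo_norm_tendsto_infinity:
  fixes M :: "nat \<Rightarrow> real \<times> real \<Rightarrow> ennreal"
  assumes fin: "\<And>N x. M N x < \<infinity>"
    and low: "\<And>N x. x \<in> {0..4} \<times> {0..1} \<Longrightarrow> ennreal (real N / 2) \<le> M N x"
    and high: "\<And>N x. x \<in> {0..4} \<times> {3..4} \<Longrightarrow> M N x \<le> 2"
  shows "(\<lambda>N. bmo_norm (\<lambda>x. enn2real (M N x))) \<longlonglongrightarrow> \<infinity>"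
proof -
  have "ennreal ((real N / 2 - 2) / 8) \<le> bmo_norm (\<lambda>x. enn2real (M N x))" if "N \<ge> 4" for N
  proof (rule bmo_norm_ge_of_gap)
    show "real N / 2 \<le> enn2real (M N x)" if "x \<in> {0..4} \<times> {0..1}" for x
      using enn2real_mono[OF low[OF that] fin[of N x, simplified infinity_ennreal_def]] by simp
    show "enn2real (M N x) \<le> 2" if "x \<in> {0..4} \<times> {3..4}" for x
      using high[OF that, of N] by (intro enn2real_leI) auto
  qed (use that in simp)
  then have lower: "\<forall>\<^sub>F N in sequentially. ennreal ((real N / 2 - 2) / 8) \<le> bmo_norm (\<lambda>x. enn2real (M N x))"
    by (rule eventually_sequentiallyI)
  have "(\<lambda>N. ennreal ((real N / 2 - 2) / 8)) \<longlonglongrightarrow> \<infinity>"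
    unfolding infinity_ennreal_def ennreal_tendsto_top_eq_at_top by real_asymp
  from lower _ this tendsto_const show ?thesis
    by (rule tendsto_sandwich) simp
qed

theorem theorem4p6:
  "\<exists>G :: nat \<Rightarrow> real \<times> real \<Rightarrow> real.
     (\<forall>N\<ge>1. G N \<in> borel_measurable lebesgue \<and> bounded (range (G N))) \<and>
     (SUP N\<in>{1..}. bmo_norm (G N)) < \<infinity> \<and>
     (\<lambda>N. bmo_norm (\<lambda>x. enn2real (max_e1 (G N) x))) \<longlonglongrightarrow> \<infinity> \<and>
     (\<lambda>N. bmo_norm (\<lambda>x. enn2real (strong_max (G N) x))) \<longlonglongrightarrow> \<infinity>"
proof (intro exI[of _ drifting_log] conjI allI impI)
  show bounded: "bounded (range (drifting_log N))" for N
    using drifting_log_bounds[of N] by (auto simp: bounded_iff intro!: exI[of _ "real N"])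
  show "drifting_log N \<in> borel_measurable lebesgue" for N
    by (rule measurable_completion) simp
  have "(SUP N\<in>{1..}. bmo_norm (drifting_log N)) \<le> 24"
    by (intro SUP_least bmo_norm_drifting_log_le)
  then show "(SUP N\<in>{1..}. bmo_norm (drifting_log N)) < \<infinity>"
    by (rule le_less_trans) simp
  show "(\<lambda>N. bmo_norm (\<lambda>x. enn2real (max_e1 (drifting_log N) x))) \<longlonglongrightarrow> \<infinity>"
    by (intro bmo_norm_tendsto_infinity max_e1_finite[OF bounded] max_e1_drifting_log_ge)
       (auto simp: max_e1_drifting_log_eq_0)
  show "(\<lambda>N. bmo_norm (\<lambda>x. enn2real (strong_max (drifting_log N) x))) \<longlonglongrightarrow> \<infinity>"
    by (intro bmo_norm_tendsto_infinity strong_max_finite[OF bounded] strong_max_drifting_log_ge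
        strong_max_drifting_log_le) auto
qed

end
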